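(* Let $n$ be a positive integer and let $a,b,c$ be real numbers with $a\neq 0$. Let $\mathbf{H}_{n+2}$, $\lambda_k$, $\theta_k$ ($k=0,1,\ldots,n+1$), $F_m(t;\alpha,\beta)$, $G_m(t;\alpha,\beta)$, $f$ and $g$ be as defined in the context. (a) Let $n$ be odd and let $\mu_1,\mu_2,\ldots,\mu_{n+2}$ be the zeros of $f$ (the eigenvalues of $\mathbf{H}_{n+2}$). If these are not of the form $\lambda_0$, $|\lambda_k|$, $-|\lambda_k|$, $k=1,\ldots,\frac{n+1}{2}$, and $b\,F_{\frac{n+1}{2}}(\mu_m;0,0)+n+2\neq 0$, then the vector $\mathbf{u}(\mu_m)\in\mathbb{R}^{n+2}$ whose $k$-th component, $k=1,\ldots,n+2$, is $$F_{\frac{n+1}{2}}\left(\mu_m;\frac{2(1-k)\pi}{n+2},\frac{2\pi}{n+2}\right) - \frac{b\,F_{\frac{n+1}{2}}\left(\mu_m;0,\frac{2\pi}{n+2}\right)F_{\frac{n+1}{2}}\left(\mu_m;\frac{2(1-k)\pi}{n+2},0\right)}{b\,F_{\frac{n+1}{2}}(\mu_m;0,0)+n+2}$$ is an eigenvector of $\mathbf{H}_{n+2}$ associated to $\mu_m$, $m=1,2,\ldots,n+2$. (b) Let $n$ be even and let $\nu_1,\nu_2,\ldots,\nu_{n+2}$ be the zeros of $g$ (the eigenvalues of $\mathbf{H}_{n+2}$). If these are not of the form $\lambda_0$, $|\lambda_k|$, $\lambda_{\frac{n}{2}+1}$, $-|\lambda_k|$, $k=1,\ldots,\frac{n}{2}$,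 and $b\,G_{\frac{n}{2}}(\nu_m;0,0)+n+2\neq 0$, then the vector $\mathbf{v}(\nu_m)\in\mathbb{R}^{n+2}$ whose $k$-th component, $k=1,\ldots,n+2$, is $$G_{\frac{n}{2}}\left(\nu_m;\frac{2(1-k)\pi}{n+2},\frac{2\pi}{n+2}\right) - \frac{1-(-1)^k}{\nu_m-\lambda_{\frac{n}{2}+1}} - \frac{b\left[G_{\frac{n}{2}}\left(\nu_m;\frac{2(1-k)\pi}{n+2},0\right)-\frac{1+(-1)^k}{\nu_m-\lambda_{\frac{n}{2}+1}}\right]\left[G_{\frac{n}{2}}\left(\nu_m;0,\frac{2\pi}{n+2}\right)-\frac{2}{\nu_m-\lambda_{\frac{n}{2}+1}}\right]}{b\,G_{\frac{n}{2}}(\nu_m;0,0)+n+2}$$ is an eigenvector of $\mathbf{H}_{n+2}$ associated to $\nu_m$, $m=1,2,\ldots,n+2$.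
   Context: $\mathbf{H}_{n+2}$ is the real $(n+2)\times(n+2)$ anti-tridiagonal Hankel matrix whose $(i,j)$ entry ($1\leqslant i,j\leqslant n+2$) is $a$ if $i+j=n+2$, $c$ if $i+j=n+3$, $b$ if $i+j=n+4$, and $0$ otherwise. Its eigenvalues (the zeros $\mu_m$, respectively $\nu_m$) are listed with multiplicity. Put $\omega := \mathrm{e}^{2\pi \mathrm{i}/(n+2)}$ (where $\mathrm{i}$ is the imaginary unit) and, for $k=0,1,\ldots,n+1$, $$\lambda_k := b + a\,\omega^{-nk} + c\,\omega^{-(n+1)k}, \qquad \theta_k := \arg(\lambda_k),$$ with $\arg$ the principal argument in $(-\pi,\pi]$ and $\arg(0)=0$. (The number $\lambda_0=a+b+c$ is real, and when $n$ is even $\lambda_{\frac n2+1}=a+b-c$ is real.) With $n$, and hence all $\lambda_k,\theta_k$, fixed, for an integer $m$ with $1\leqslant m\leqslant n$ and real $\alpha,\beta$ define $$F_m(t;\alpha,\beta) := \frac{1}{t-\lambda_0} + 2\sum_{k=1}^{m}\left[\frac{\cos\left(\frac{\theta_k}{2}-\alpha k\right)\cos\left(\frac{\theta_k}{2}-\beta k\right)}{t-|\lambda_k|} + \frac{\sin\left(\frac{\theta_k}{2}-\alpha k\right)\sin\left(\frac{\theta_k}{2}-\beta k\right)}{t+|\lambda_k|}\right],$$ $$G_m(t;\alpha,\beta) := \frac{1}{t-\lambda_0} + \frac{1}{t-\lambda_{m+1}} + 2\sum_{k=1}^{m}\left[\frac{\cos\left(\frac{\theta_k}{2}-\alpha k\right)\cos\left(\frac{\theta_k}{2}-\beta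 k\right)}{t-|\lambda_k|} + \frac{\sin\left(\frac{\theta_k}{2}-\alpha k\right)\sin\left(\frac{\theta_k}{2}-\beta k\right)}{t+|\lambda_k|}\right].$$ For $n$ odd, $$f(t) := 1 + \frac{a}{n+2} F_{\frac{n+1}{2}}\left(t;\frac{2\pi}{n+2},\frac{2\pi}{n+2}\right) + \frac{b}{n+2} F_{\frac{n+1}{2}}(t;0,0) + \frac{ab}{(n+2)^2} F_{\frac{n+1}{2}}\left(t;\frac{2\pi}{n+2},\frac{2\pi}{n+2}\right) F_{\frac{n+1}{2}}(t;0,0) - \frac{ab}{(n+2)^2} \left[F_{\frac{n+1}{2}}\left(t;0,\frac{2\pi}{n+2}\right)\right]^2,$$ and for $n$ even, $$g(t) := 1 + \frac{a}{n+2} G_{\frac{n}{2}}\left(t;\frac{2\pi}{n+2},\frac{2\pi}{n+2}\right) + \frac{b}{n+2} G_{\frac{n}{2}}(t;0,0) + \frac{ab}{(n+2)^2} G_{\frac{n}{2}}\left(t;\frac{2\pi}{n+2},\frac{2\pi}{n+2}\right) G_{\frac{n}{2}}(t;0,0) - \frac{ab}{(n+2)^2} \left[G_{\frac{n}{2}}\left(t;0,\frac{2\pi}{n+2}\right) - \frac{2}{t-\lambda_{\frac{n}{2}+1}}\right]^2 .$$ *)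

theory Defs
  imports Complex_Main "Jordan_Normal_Form.Char_Poly"
begin

text \<open>
  Matrix and vector entries are numbered from 1 on paper, whereas \<^const>\<open>mat\<close> and
  \<^const>\<open>vec\<close> number them from 0; entries are therefore given by functions of 1-based
  indices, which are shifted when the matrix or vector is formed.
\<close>

definition hankel_entry :: "nat \<Rightarrow> real \<Rightarrow> real \<Rightarrow> real \<Rightarrow> nat \<Rightarrow> nat \<Rightarrow> real" where
  "hankel_entry n a b c i j =
     (if i + j = n + 2 then a
      else if i + j = n + 3 then c
      else if i + j = n + 4 then b
      else 0)"

definition hankel :: "nat \<Rightarrow> real \<Rightarrow> real \<Rightarrow> real \<Rightarrow> real mat" where
  "hankel n a b c = mat (n + 2) (n + 2) (\<lambda>(i, j). hankel_entry n a b c (Suc i) (Suc j))"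

definition omega :: "nat \<Rightarrow> complex" where
  "omega n = exp (2 * of_real pi * \<i> / of_nat (n + 2))"

definition lam :: "nat \<Rightarrow> real \<Rightarrow> real \<Rightarrow> real \<Rightarrow> nat \<Rightarrow> complex" where
  "lam n a b c k =
     of_real b + of_real a * omega n powi (- int (n * k))
               + of_real c * omega n powi (- int ((n + 1) * k))"

definition theta :: "nat \<Rightarrow> real \<Rightarrow> real \<Rightarrow> real \<Rightarrow> nat \<Rightarrow> real" where
  "theta n a b c k = Arg (lam n a b c k)"

lemma lam_0: "lam n a b c 0 = of_real (a + b + c)"
  by (simp add: lam_def)

lemma lam_half:
  assumes "even n"
  shows "lam n a b c (n div 2 + 1) = of_real (a + b - c)"
proof -
  obtain p where n: "n = 2 * p" using assms by (elim evenE)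
  let ?k = "n div 2 + 1"
  have "omega n ^ ?k = exp (of_nat ?k * (2 * of_real pi * \<i> / of_nat (n + 2)))"
    unfolding omega_def by (rule exp_of_nat_mult [symmetric])
  also have "of_nat ?k * (2 * of_real pi * \<i> / of_nat (n + 2)) = of_real pi * \<i>"
  proof -
    have N: "(of_nat (n + 2) :: complex) = 2 * of_nat ?k" by (simp add: n)
    have "(of_nat ?k :: complex) \<noteq> 0" using of_nat_neq_0 [of "n div 2"] by simp
    moreover have "z * (2 * of_real pi * \<i> / (2 * z)) = of_real pi * \<i>" if "z \<noteq> 0" for z :: complex
      using that by simp
    ultimately show ?thesis unfolding N by blast
  qed
  finally have w: "omega n ^ ?k = -1" by (simp add: exp_pi_i)
  have *: "omega n powi (- int (m * ?k)) = inverse ((-1) ^ m)" for m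
  proof -
    have "omega n powi (- int (m * ?k)) = inverse (omega n ^ (m * ?k))"
      by (metis power_int_minus power_int_of_nat)
    also have "omega n ^ (m * ?k) = (omega n ^ ?k) ^ m"
      by (metis mult.commute power_mult)
    finally show ?thesis by (simp only: w)
  qed
  show ?thesis unfolding lam_def * using assms by simp
qed

text \<open>
  The summands outside the sums are real because \<open>lam n a b c 0\<close> is real by \<open>lam_0\<close> and
  because \<open>G_fun\<close> is only used with \<open>m = n div 2\<close> for even \<open>n\<close>, where \<open>lam n a b c (m + 1)\<close>
  is real by \<open>lam_half\<close>; so taking real parts changes nothing.
\<close>

definition F_fun ::
    "nat \<Rightarrow> real \<Rightarrow> real \<Rightarrow> real \<Rightarrow> nat \<Rightarrow> real \<Rightarrow> real \<Rightarrow> real \<Rightarrow> real" where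
  "F_fun n a b c m t \<alpha> \<beta> =
     1 / (t - Re (lam n a b c 0))
     + 2 * (\<Sum>k = 1..m.
         cos (theta n a b c k / 2 - \<alpha> * real k) * cos (theta n a b c k / 2 - \<beta> * real k)
           / (t - cmod (lam n a b c k))
       + sin (theta n a b c k / 2 - \<alpha> * real k) * sin (theta n a b c k / 2 - \<beta> * real k)
           / (t + cmod (lam n a b c k)))"

definition G_fun ::
    "nat \<Rightarrow> real \<Rightarrow> real \<Rightarrow> real \<Rightarrow> nat \<Rightarrow> real \<Rightarrow> real \<Rightarrow> real \<Rightarrow> real" where
  "G_fun n a b c m t \<alpha> \<beta> =
     1 / (t - Re (lam n a b c 0)) + 1 / (t - Re (lam n a b c (m + 1)))
     + 2 * (\<Sum>k = 1..m.
         cos (theta n a b c k / 2 - \<alpha> * real k) * cos (theta n a b c k / 2 - \<beta> * real k)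
           / (t - cmod (lam n a b c k))
       + sin (theta n a b c k / 2 - \<alpha> * real k) * sin (theta n a b c k / 2 - \<beta> * real k)
           / (t + cmod (lam n a b c k)))"

definition f_odd :: "nat \<Rightarrow> real \<Rightarrow> real \<Rightarrow> real \<Rightarrow> real \<Rightarrow> real" where
  "f_odd n a b c t =
     (let N = real n + 2; \<phi> = 2 * pi / N; F = F_fun n a b c ((n + 1) div 2) t in
        1 + a / N * F \<phi> \<phi> + b / N * F 0 0
          + a * b / N\<^sup>2 * F \<phi> \<phi> * F 0 0
          - a * b / N\<^sup>2 * (F 0 \<phi>)\<^sup>2)"

definition g_even :: "nat \<Rightarrow> real \<Rightarrow> real \<Rightarrow> real \<Rightarrow> real \<Rightarrow> real" where
  "g_even n a b c t =
     (let N = real n + 2; \<phi> = 2 * pi / N; G = G_fun n a b c (n div 2) t;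
          d = t - Re (lam n a b c (n div 2 + 1)) in
        1 + a / N * G \<phi> \<phi> + b / N * G 0 0
          + a * b / N\<^sup>2 * G \<phi> \<phi> * G 0 0
          - a * b / N\<^sup>2 * (G 0 \<phi> - 2 / d)\<^sup>2)"

definition u_entry :: "nat \<Rightarrow> real \<Rightarrow> real \<Rightarrow> real \<Rightarrow> real \<Rightarrow> nat \<Rightarrow> real" where
  "u_entry n a b c t k =
     (let N = real n + 2; \<phi> = 2 * pi / N; \<psi> = 2 * (1 - real k) * pi / N;
          F = F_fun n a b c ((n + 1) div 2) t in
        F \<psi> \<phi> - b * F 0 \<phi> * F \<psi> 0 / (b * F 0 0 + N))"

definition u_vec :: "nat \<Rightarrow> real \<Rightarrow> real \<Rightarrow> real \<Rightarrow> real \<Rightarrow> real vec" where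
  "u_vec n a b c t = vec (n + 2) (\<lambda>i. u_entry n a b c t (Suc i))"

definition v_entry :: "nat \<Rightarrow> real \<Rightarrow> real \<Rightarrow> real \<Rightarrow> real \<Rightarrow> nat \<Rightarrow> real" where
  "v_entry n a b c t k =
     (let N = real n + 2; \<phi> = 2 * pi / N; \<psi> = 2 * (1 - real k) * pi / N;
          G = G_fun n a b c (n div 2) t;
          d = t - Re (lam n a b c (n div 2 + 1)) in
        G \<psi> \<phi> - (1 - (-1) ^ k) / d
          - b * (G \<psi> 0 - (1 + (-1) ^ k) / d) * (G 0 \<phi> - 2 / d) / (b * G 0 0 + N))"

definition v_vec :: "nat \<Rightarrow> real \<Rightarrow> real \<Rightarrow> real \<Rightarrow> real \<Rightarrow> real vec" where
  "v_vec n a b c t = vec (n + 2) (\<lambda>i. v_entry n a b c t (Suc i))"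

text \<open>
  Division by zero yields zero in HOL, so a zero of the rational function \<open>f_odd\<close> or \<open>g_even\<close>
  has to be required not to be one of its possible poles.
\<close>

definition pole_form_odd :: "nat \<Rightarrow> real \<Rightarrow> real \<Rightarrow> real \<Rightarrow> real \<Rightarrow> bool" where
  "pole_form_odd n a b c t \<longleftrightarrow>
     complex_of_real t = lam n a b c 0 \<or>
     (\<exists>k\<in>{1..(n + 1) div 2}. t = cmod (lam n a b c k) \<or> t = - cmod (lam n a b c k))"

definition pole_form_even :: "nat \<Rightarrow> real \<Rightarrow> real \<Rightarrow> real \<Rightarrow> real \<Rightarrow> bool" where
  "pole_form_even n a b c t \<longleftrightarrow>
     complex_of_real t = lam n a b c 0 \<or>
     complex_of_real t = lam n a b c (n div 2 + 1) \<or>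
     (\<exists>k\<in>{1..n div 2}. t = cmod (lam n a b c k) \<or> t = - cmod (lam n a b c k))"

text \<open>\<open>\<mu> 1, \<dots>, \<mu> (n + 2)\<close> are the eigenvalues of the matrix, listed with multiplicity.\<close>

definition lists_eigenvalues :: "nat \<Rightarrow> real \<Rightarrow> real \<Rightarrow> real \<Rightarrow> (nat \<Rightarrow> real) \<Rightarrow> bool" where
  "lists_eigenvalues n a b c \<mu> \<longleftrightarrow>
     char_poly (hankel n a b c) = (\<Prod>m = 1..n + 2. [:- \<mu> m, 1:])"

end

theory Submission
  imports Defs
begin

text \<open>
  Wrapping the three antidiagonals of the Hankel matrix around modulo \<open>N = n + 2\<close> changes only
  two entries: it adds \<open>b\<close> in the first and \<open>a\<close> in the last diagonal position. So the Hankel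
  matrix is an anticirculant matrix \<open>C\<close> minus \<open>b e\<^sub>p e\<^sub>p\<^sup>T + a e\<^sub>q e\<^sub>q\<^sup>T\<close>, where \<open>p = 0\<close>
  and \<open>q = n + 1\<close> in the indexing from zero.

  An anticirculant matrix maps a plane wave of frequency \<open>k\<close> to the conjugate wave, scaled by the
  conjugate of \<open>\<lambda>\<^sub>k\<close>. Shifting the phase by half the argument \<open>\<theta>\<^sub>k\<close> of \<open>\<lambda>\<^sub>k\<close> therefore
  gives real eigenvectors: the cosine wave with eigenvalue \<open>\<bar>\<lambda>\<^sub>k\<bar>\<close> and the sine wave with
  eigenvalue \<open>- \<bar>\<lambda>\<^sub>k\<bar>\<close>. Frequencies \<open>k\<close> and \<open>N - k\<close> give the same contributions to
  the spectral expansion of \<open>R = (t - C)\<^sup>-\<^sup>1\<close>, so half of the frequencies suffice, all counted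
  twice except \<open>0\<close> and \<open>N / 2\<close>; this is where the factor 2 in the trigonometric sums and the
  dependence on the parity of \<open>n\<close> come from. That the expansion is the inverse is checked directly
  (\<open>resolvent_kernel\<close>): applying \<open>t - C\<close> cancels the denominators
  (\<open>mode_resolvent\<close>), and what is left is the orthogonality relation of the \<open>N\<close>-th roots of
  unity (\<open>half_spectrum_orthogonality\<close>).

  Given the resolvent of \<open>C\<close>, the equation \<open>H v = t v\<close> says
  \<open>(t - C) v = - b v\<^sub>p e\<^sub>p - a v\<^sub>q e\<^sub>q\<close>. Hence \<open>v\<close> is a combination of the columns \<open>p\<close> and
  \<open>q\<close> of \<open>R\<close>, and comparing the components \<open>p\<close> and \<open>q\<close> leaves a homogeneous system of two
  equations. Its determinant is the function whose zeros are the eigenvalues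
  (\<open>eigenvalue_iff_secular\<close>), and eliminating with the pivot \<open>1 + b R\<^sub>p\<^sub>p\<close> gives the eigenvector
  (\<open>eigenvector_explicit\<close>). Finally \<open>F_fun_eq_kernel\<close> and \<open>G_fun_eq_kernel\<close> identify the
  trigonometric sums with the entries of \<open>N R\<close>.
\<close>

section \<open>Two diagonal corrections of a matrix with known resolvent\<close>

text \<open>
  Stating the inverse of \<open>t - A\<close> entrywise, with both one-sided conditions, lets an explicit formula
  for \<open>R\<close> be used without introducing an inverse matrix: the right inverse produces eigenvectors, and
  the left inverse shows that there are no others.
\<close>

locale resolvent =
  fixes N :: nat and A R :: "nat \<Rightarrow> nat \<Rightarrow> 'a :: field" and t :: 'a
  assumes right_inverse:
      "\<lbrakk>i < N; j < N\<rbrakk> \<Longrightarrow> t * R i j - (\<Sum>l<N. A i l * R l j) = of_bool (i = j)"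
    and left_inverse:
      "\<lbrakk>i < N; j < N\<rbrakk> \<Longrightarrow> t * R i j - (\<Sum>l<N. R i l * A l j) = of_bool (i = j)"
begin

lemma solution_eq_resolvent:
  assumes "\<And>i. i < N \<Longrightarrow> t * v i - (\<Sum>l<N. A i l * v l) = w i" and i: "i < N"
  shows "v i = (\<Sum>l<N. R i l * w l)"
proof -
  have "(\<Sum>l<N. R i l * w l) = (\<Sum>l<N. R i l * (t * v l - (\<Sum>j<N. A l j * v j)))"
    using assms(1) by simp
  also have "\<dots> = (\<Sum>l<N. t * R i l * v l) - (\<Sum>l<N. \<Sum>j<N. R i l * A l j * v j)"
    by (simp add: right_diff_distrib sum_subtractf sum_distrib_left mult_ac)
  also have "(\<Sum>l<N. \<Sum>j<N. R i l * A l j * v j) = (\<Sum>j<N. (\<Sum>l<N. R i l * A l j) * v j)"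
    by (subst sum.swap) (simp add: sum_distrib_right)
  also have "(\<Sum>l<N. t * R i l * v l) - \<dots> = (\<Sum>j<N. (t * R i j - (\<Sum>l<N. R i l * A l j)) * v j)"
    by (simp add: left_diff_distrib sum_subtractf)
  also have "\<dots> = (\<Sum>j<N. of_bool (i = j) * v j)"
    using i by (intro sum.cong) (simp_all add: left_inverse)
  also have "\<dots> = v i"
    using i by (simp add: of_bool_def if_distrib [of "\<lambda>x. x * _"] cong: if_cong)
  finally show ?thesis ..
qed

end

lemma singular_two_by_two_iff:
  fixes x11 x12 x21 x22 :: "'a :: field"
  shows "x11 * x22 - x12 * x21 = 0 \<longleftrightarrow>
    (\<exists>x y. (x \<noteq> 0 \<or> y \<noteq> 0) \<and> x11 * x + x12 * y = 0 \<and> x21 * x + x22 * y = 0)"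
proof
  assume det: "x11 * x22 - x12 * x21 = 0"
  \<comment> \<open>A nonzero row, rotated by a right angle, spans the kernel.\<close>
  consider "x11 = 0 \<and> x12 = 0 \<and> x21 = 0 \<and> x22 = 0" | "x11 \<noteq> 0 \<or> x12 \<noteq> 0" | "x21 \<noteq> 0 \<or> x22 \<noteq> 0"
    by blast
  then show "\<exists>x y. (x \<noteq> 0 \<or> y \<noteq> 0) \<and> x11 * x + x12 * y = 0 \<and> x21 * x + x22 * y = 0"
  proof cases
    case 1
    then show ?thesis by (intro exI [of _ 1]) simp
  next
    case 2
    then show ?thesis
      using det by (intro exI [of _ "- x12"] exI [of _ x11]) (auto simp: algebra_simps)
  next
    case 3
    then show ?thesis
      using det by (intro exI [of _ x22] exI [of _ "- x21"]) (auto simp: algebra_simps)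
  qed
next
  assume "\<exists>x y. (x \<noteq> 0 \<or> y \<noteq> 0) \<and> x11 * x + x12 * y = 0 \<and> x21 * x + x22 * y = 0"
  then obtain x y where nonzero: "x \<noteq> 0 \<or> y \<noteq> 0"
    and rows: "x11 * x + x12 * y = 0" "x21 * x + x22 * y = 0" by blast
  have "(x11 * x22 - x12 * x21) * x = x22 * (x11 * x + x12 * y) - x12 * (x21 * x + x22 * y)"
    "(x11 * x22 - x12 * x21) * y = x11 * (x21 * x + x22 * y) - x21 * (x11 * x + x12 * y)"
    by (simp_all add: algebra_simps)
  with nonzero rows show "x11 * x22 - x12 * x21 = 0" by (metis diff_zero mult_eq_0_iff)
qed

locale two_diagonal_corrections = resolvent +
  fixes p q :: nat and a b :: "'a :: field" and H :: "'a mat"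
  assumes p: "p < N" and q: "q < N" and distinct: "p \<noteq> q"
    and H_dim: "H \<in> carrier_mat N N"
    and H_entry: "\<lbrakk>i < N; j < N\<rbrakk> \<Longrightarrow>
      H $$ (i, j) = A i j - (if i = p \<and> j = p then b else 0) - (if i = q \<and> j = q then a else 0)"
begin

lemma H_mult:
  assumes "i < N"
  shows "(H *\<^sub>v vec N v) $ i
    = (\<Sum>l<N. A i l * v l) - (if i = p then b * v p else 0) - (if i = q then a * v q else 0)"
proof -
  have "(H *\<^sub>v vec N v) $ i = (\<Sum>l<N. H $$ (i, l) * v l)"
    using assms H_dim by (auto simp: scalar_prod_def lessThan_atLeast0 intro!: sum.cong)
  also have "\<dots> = (\<Sum>l<N. A i l * v l - (if l = p then (if i = p then b * v p else 0) else 0)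
      - (if l = q then (if i = q then a * v q else 0) else 0))"
    using assms by (intro sum.cong) (auto simp: H_entry algebra_simps)
  also have "\<dots> = (\<Sum>l<N. A i l * v l) - (if i = p then b * v p else 0)
      - (if i = q then a * v q else 0)"
    using p q by (simp add: sum_subtractf)
  finally show ?thesis .
qed

lemma eigenvector_iff:
  "eigenvector H (vec N v) t \<longleftrightarrow> (\<exists>i<N. v i \<noteq> 0) \<and>
     (\<forall>i<N. t * v i - (\<Sum>l<N. A i l * v l)
              = - (if i = p then b * v p else 0) - (if i = q then a * v q else 0))"
proof -
  have eq: "H *\<^sub>v vec N v = t \<cdot>\<^sub>v vec N v \<longleftrightarrow>
      (\<forall>i<N. t * v i - (\<Sum>l<N. A i l * v l)
              = - (if i = p then b * v p else 0) - (if i = q then a * v q else 0))"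
  proof -
    have "H *\<^sub>v vec N v = t \<cdot>\<^sub>v vec N v \<longleftrightarrow> (\<forall>i<N. (H *\<^sub>v vec N v) $ i = t * v i)"
      using H_dim by (auto simp: vec_eq_iff)
    also have "\<dots> \<longleftrightarrow> (\<forall>i<N. t * v i - (\<Sum>l<N. A i l * v l)
              = - (if i = p then b * v p else 0) - (if i = q then a * v q else 0))"
      by (intro all_cong) (auto simp: H_mult algebra_simps)
    finally show ?thesis .
  qed
  have "vec N v \<noteq> 0\<^sub>v N \<longleftrightarrow> (\<exists>i<N. v i \<noteq> 0)"
    by (auto simp: vec_eq_iff)
  then show ?thesis
    using H_dim eq by (auto simp: eigenvector_def)
qed

definition secular :: 'a where
  "secular = (1 + b * R p p) * (1 + a * R q q) - a * b * R p q * R q p"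

lemma combination_of_columns:
  assumes "i < N"
  shows "t * (x * R i p + y * R i q) - (\<Sum>l<N. A i l * (x * R l p + y * R l q))
    = (if i = p then x else 0) + (if i = q then y else 0)"
proof -
  have "t * (x * R i p + y * R i q) - (\<Sum>l<N. A i l * (x * R l p + y * R l q))
      = x * (t * R i p - (\<Sum>l<N. A i l * R l p)) + y * (t * R i q - (\<Sum>l<N. A i l * R l q))"
    by (simp add: algebra_simps sum.distrib sum_distrib_left)
  then show ?thesis
    using assms p q by (simp add: right_inverse)
qed

text \<open>
  The two rows say that \<open>- b v\<^sub>p = x\<close> and \<open>- a v\<^sub>q = y\<close> for the combination \<open>v\<close> of columns,
  so that \<open>(t - A) v = x e\<^sub>p + y e\<^sub>q\<close> turns into \<open>H v = t v\<close>. They also keep \<open>v\<close> from being zero,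
  since otherwise \<open>x\<close> and \<open>y\<close> would vanish.
\<close>

lemma eigenvector_combination:
  assumes p_row: "(1 + b * R p p) * x + b * R p q * y = 0"
    and q_row: "a * R q p * x + (1 + a * R q q) * y = 0"
    and nonzero: "x \<noteq> 0 \<or> y \<noteq> 0"
  shows "eigenvector H (vec N (\<lambda>i. x * R i p + y * R i q)) t"
proof -
  have x: "b * (x * R p p + y * R p q) = - x" and y: "a * (x * R q p + y * R q q) = - y"
    using p_row q_row by (simp_all add: algebra_simps eq_neg_iff_add_eq_0)
  have "x * R p p + y * R p q \<noteq> 0 \<or> x * R q p + y * R q q \<noteq> 0"
    using nonzero x y by (metis mult_zero_right neg_equal_0_iff_equal)
  then have "\<exists>i<N. x * R i p + y * R i q \<noteq> 0"
    using p q by blast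
  moreover have "t * (x * R i p + y * R i q) - (\<Sum>l<N. A i l * (x * R l p + y * R l q))
      = - (if i = p then b * (x * R p p + y * R p q) else 0)
        - (if i = q then a * (x * R q p + y * R q q) else 0)" if "i < N" for i
    unfolding combination_of_columns [OF that] x y using distinct by simp
  ultimately show ?thesis
    by (simp add: eigenvector_iff)
qed

text \<open>
  Every eigenvector is a combination of columns \<open>p\<close> and \<open>q\<close> of the resolvent with coefficients
  \<open>- b v\<^sub>p\<close> and \<open>- a v\<^sub>q\<close>, so eigenvectors correspond to the nonzero solutions of a system
  of two equations whose determinant is the secular function.
\<close>

lemma eigenvalue_iff_secular: "eigenvalue H t \<longleftrightarrow> secular = 0"
proof -
  have "eigenvalue H t \<longleftrightarrow> (\<exists>x y. (x \<noteq> 0 \<or> y \<noteq> 0) \<and>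
      (1 + b * R p p) * x + b * R p q * y = 0 \<and> a * R q p * x + (1 + a * R q q) * y = 0)"
  proof
    assume "eigenvalue H t"
    then obtain v where v: "eigenvector H v t"
      by (auto simp: eigenvalue_def)
    define f where "f = (\<lambda>i. v $ i)"
    have "v = vec N f"
      using v H_dim by (auto simp: eigenvector_def f_def)
    with v have f: "eigenvector H (vec N f) t" by simp
    define x y where "x = - b * f p" and "y = - a * f q"
    have f_eq: "f i = x * R i p + y * R i q" if "i < N" for i
    proof -
      have "f i = (\<Sum>l<N. R i l * (- (if l = p then b * f p else 0) - (if l = q then a * f q else 0)))"
        using f that by (intro solution_eq_resolvent) (auto simp: eigenvector_iff)
      also have "\<dots> = (\<Sum>l<N. (if l = p then x * R i p else 0) + (if l = q then y * R i q else 0))"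
        by (intro sum.cong) (auto simp: x_def y_def algebra_simps)
      also have "\<dots> = x * R i p + y * R i q"
        using p q by (simp add: sum.distrib)
      finally show ?thesis .
    qed
    have "x \<noteq> 0 \<or> y \<noteq> 0"
      using f by (auto simp: eigenvector_iff f_eq)
    moreover have "x + b * (x * R p p + y * R p q) = 0" "y + a * (x * R q p + y * R q q) = 0"
      unfolding f_eq [OF p, symmetric] f_eq [OF q, symmetric] by (simp_all add: x_def y_def)
    ultimately show "\<exists>x y. (x \<noteq> 0 \<or> y \<noteq> 0) \<and>
        (1 + b * R p p) * x + b * R p q * y = 0 \<and> a * R q p * x + (1 + a * R q q) * y = 0"
      by (intro exI [of _ x] exI [of _ y]) (simp add: algebra_simps)
  next
    assume "\<exists>x y. (x \<noteq> 0 \<or> y \<noteq> 0) \<and>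
      (1 + b * R p p) * x + b * R p q * y = 0 \<and> a * R q p * x + (1 + a * R q q) * y = 0"
    then show "eigenvalue H t"
      using eigenvector_combination unfolding eigenvalue_def by blast
  qed
  also have "\<dots> \<longleftrightarrow> secular = 0"
    unfolding singular_two_by_two_iff [symmetric] secular_def by (simp add: mult_ac)
  finally show ?thesis .
qed

text \<open>
  With the coefficient of column \<open>q\<close> normalized, the first of the two equations determines that of
  column \<open>p\<close>; the second one then amounts to the secular equation. The scaling factor \<open>s\<close>
  serves to clear a common denominator of the resolvent entries.
\<close>

lemma eigenvector_explicit:
  assumes sec: "secular = 0" and pivot: "1 + b * R p p \<noteq> 0" and s: "s \<noteq> 0"
  shows "eigenvector H (vec N (\<lambda>i. s * (R i q - b * R p q / (1 + b * R p p) * R i p))) t"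
proof -
  define \<beta> where "\<beta> = b * R p q / (1 + b * R p p)"
  have \<beta>: "(1 + b * R p p) * \<beta> = b * R p q"
    using pivot by (simp add: \<beta>_def)
  have "eigenvector H (vec N (\<lambda>i. (- s * \<beta>) * R i p + s * R i q)) t"
  proof (rule eigenvector_combination)
    have "(1 + b * R p p) * (- s * \<beta>) + b * R p q * s = s * (b * R p q - (1 + b * R p p) * \<beta>)"
      by (simp add: algebra_simps)
    also have "\<dots> = 0"
      unfolding \<beta> by simp
    finally show "(1 + b * R p p) * (- s * \<beta>) + b * R p q * s = 0" .
    have "(1 + b * R p p) * (a * R q p * (- s * \<beta>) + (1 + a * R q q) * s)
        = s * ((1 + b * R p p) * (1 + a * R q q) - a * R q p * ((1 + b * R p p) * \<beta>))"
      by (simp add: algebra_simps)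
    also have "\<dots> = s * secular"
      unfolding \<beta> secular_def by (simp only: mult_ac)
    also have "\<dots> = 0"
      unfolding sec by simp
    finally show "a * R q p * (- s * \<beta>) + (1 + a * R q q) * s = 0"
      using pivot by (simp only: mult_eq_0_iff simp_thms)
  qed (use s in simp)
  moreover have "(\<lambda>i. (- s * \<beta>) * R i p + s * R i q)
      = (\<lambda>i. s * (R i q - b * R p q / (1 + b * R p p) * R i p))"
    unfolding \<beta>_def [symmetric] by (simp add: algebra_simps)
  ultimately show ?thesis by (rule back_subst [of "\<lambda>f. eigenvector H (vec N f) t"])
qed

end

section \<open>The anticirculant completion\<close>

definition anticirculant :: "nat \<Rightarrow> real \<Rightarrow> real \<Rightarrow> real \<Rightarrow> nat \<Rightarrow> nat \<Rightarrow> real" where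
  "anticirculant n a b c i j =
     (let s = (i + j) mod (n + 2) in
      if s = 0 then b else if s = n then a else if s = n + 1 then c else 0)"

lemma anticirculant_commute: "anticirculant n a b c i j = anticirculant n a b c j i"
  by (simp add: anticirculant_def add.commute)

text \<open>
  Wrapping around adds just the positions whose indices sum to \<open>0\<close> or \<open>2 n + 2\<close>, the two extreme
  corners of the diagonal. For \<open>n = 0\<close> the residues \<open>0\<close> and \<open>n\<close> would coincide.
\<close>

lemma hankel_eq_anticirculant:
  assumes "n \<ge> 1" "i < n + 2" "j < n + 2"
  shows "hankel n a b c $$ (i, j) = anticirculant n a b c i j
    - (if i = 0 \<and> j = 0 then b else 0) - (if i = n + 1 \<and> j = n + 1 then a else 0)"
proof (cases "i + j < n + 2")
  case True
  then show ?thesis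
    using assms by (auto simp: hankel_def hankel_entry_def anticirculant_def Let_def)
next
  case False
  with assms have "(i + j) mod (n + 2) = i + j - (n + 2)"
    by (simp add: mod_if)
  then show ?thesis
    using assms False by (auto simp: hankel_def hankel_entry_def anticirculant_def Let_def)
qed

lemma sum_shift_mod:
  fixes g :: "nat \<Rightarrow> 'a :: comm_monoid_add"
  assumes "N > 0"
  shows "(\<Sum>l<N. g ((i + l) mod N)) = (\<Sum>s<N. g s)"
proof -
  have "inj_on (\<lambda>l. (i + l) mod N) {..<N}"
  proof (rule linorder_inj_onI')
    fix l l' assume "l \<in> {..<N}" "l' \<in> {..<N}" "l < l'"
    then have "\<not> N dvd (i + l') - (i + l)"
      by (auto dest: dvd_imp_le)
    with \<open>l < l'\<close> show "(i + l) mod N \<noteq> (i + l') mod N"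
      by (metis add_le_cancel_left less_imp_le mod_eq_dvd_iff_nat)
  qed
  moreover have "(\<lambda>l. (i + l) mod N) ` {..<N} \<subseteq> {..<N}"
    using assms by auto
  ultimately have "bij_betw (\<lambda>l. (i + l) mod N) {..<N} {..<N}"
    by (simp add: bij_betw_def endo_inj_surj)
  then show ?thesis by (rule sum.reindex_bij_betw)
qed

lemma periodic_int_multiple:
  fixes f :: "int \<Rightarrow> 'a"
  assumes "\<And>x. f (x + N) = f x"
  shows "f (x + k * N) = f x"
proof (induction k rule: int_induct [where k = 0])
  case (step1 i)
  then show ?case using assms [of "x + i * N"] by (simp add: algebra_simps)
next
  case (step2 i)
  then show ?case using assms [of "x + (i - 1) * N"] by (simp add: algebra_simps)
qed simp

text \<open>
  The column index can be replaced by the residue of row plus column, because the function is periodic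
  and a shift permutes the residues; the coefficients \<open>b\<close>, \<open>a\<close> and \<open>c\<close> then pick out its values
  at \<open>- i\<close>, \<open>n - i\<close> and \<open>n + 1 - i\<close>.
\<close>

lemma anticirculant_periodic:
  fixes f :: "int \<Rightarrow> real"
  assumes "n \<ge> 1" and f: "\<And>x. f (x + int (n + 2)) = f x"
  shows "(\<Sum>l<n + 2. anticirculant n a b c i l * f (int l))
    = b * f (- int i) + a * f (- int i - 2) + c * f (- int i - 1)"
proof -
  define h where "h s = (if s = 0 then b else if s = n then a else if s = n + 1 then c else 0)"
    for s :: nat
  define g where "g s = h s * f (int s - int i)" for s :: nat
  have "f (int l) = f (int ((i + l) mod (n + 2)) - int i)" for l
  proof -
    have "int ((i + l) mod (n + 2)) - int i + int ((i + l) div (n + 2)) * int (n + 2) = int l"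
      using mod_mult_div_eq [of "i + l" "n + 2"] by (smt (verit) mult.commute of_nat_add of_nat_mult)
    then show ?thesis
      using periodic_int_multiple [of f "int (n + 2)", OF f] by metis
  qed
  then have "(\<Sum>l<n + 2. anticirculant n a b c i l * f (int l))
      = (\<Sum>l<n + 2. g ((i + l) mod (n + 2)))"
    by (intro sum.cong) (simp_all add: anticirculant_def h_def g_def Let_def)
  also have "\<dots> = (\<Sum>s<n + 2. g s)"
    by (rule sum_shift_mod) simp
  also have "\<dots> = g 0 + g n + g (n + 1)"
  proof -
    have "(\<Sum>s<n. g s) = g 0"
    proof -
      have "(\<Sum>s<n. g s) = (\<Sum>s\<in>{0}. g s)"
        using assms(1) by (intro sum.mono_neutral_right) (auto simp: g_def h_def)
      then show ?thesis by simp
    qed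
    then show ?thesis by (simp add: numeral_2_eq_2)
  qed
  also have "\<dots> = b * f (- int i) + a * f (- int i - 2) + c * f (- int i - 1)"
  proof -
    have "f (int n - int i) = f (- int i - 2)" "f (int (n + 1) - int i) = f (- int i - 1)"
      using f [of "- int i - 2"] f [of "- int i - 1"] by (simp_all add: algebra_simps)
    then show ?thesis using assms(1) by (simp add: g_def h_def)
  qed
  finally show ?thesis .
qed

definition angle_step :: "nat \<Rightarrow> real" where
  "angle_step n = 2 * pi / (real n + 2)"

lemma step_period: "(real n + 2) * angle_step n = 2 * pi"
  by (simp add: angle_step_def)

lemma cis_add_2pi_int: "cis (x + 2 * pi * of_int j) = cis x"
  by (simp add: cis_mult [symmetric] cis_multiple_2pi)

text \<open>
  The negative powers of \<open>\<omega>\<close> reduce to the frequencies \<open>2 k\<close> and \<open>k\<close> because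
  \<open>- n \<equiv> 2\<close> and \<open>- (n + 1) \<equiv> 1\<close> modulo \<open>n + 2\<close>.
\<close>

lemma lam_cis:
  "lam n a b c k = of_real b + of_real a * cis (2 * (real k * angle_step n))
     + of_real c * cis (real k * angle_step n)"
proof -
  have om: "omega n = cis (angle_step n)"
    by (simp add: omega_def angle_step_def cis_conv_exp mult_ac) (metis add.commute)
  have pw: "omega n powi (- int (r * k)) = cis (real s * (real k * angle_step n))" if "r + s = n + 2"
    for r s
  proof -
    have "omega n powi (- int (r * k)) = cis (- real (r * k) * angle_step n)"
      unfolding om by (metis cis_power_int of_int_minus of_int_of_nat_eq)
    also have "- real (r * k) * angle_step n
        = real s * (real k * angle_step n) - real k * ((real n + 2) * angle_step n)"
    proof -
      have "real n + 2 = real r + real s"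
        using that by linarith
      then show ?thesis
        by (simp only: of_nat_mult) (simp add: algebra_simps)
    qed
    also have "\<dots> = real s * (real k * angle_step n) + 2 * pi * of_int (- int k)"
      by (simp add: step_period)
    finally show ?thesis by (simp only: cis_add_2pi_int)
  qed
  show ?thesis
    unfolding lam_def using pw [of n 2] pw [of "n + 1" 1] by simp
qed

text \<open>
  In row \<open>0\<close> the three entries sum the wave to its phase factor times the conjugate of
  \<open>\<lambda>\<^sub>k\<close>. One row further down, the entries sit one column further to the left, so the row index
  enters with a negative sign.
\<close>

lemma anticirculant_wave:
  assumes "n \<ge> 1"
  shows "(\<Sum>l<n + 2. anticirculant n a b c i l * cos (\<delta> + real k * angle_step n * real l))
    = Re (cnj (lam n a b c k) * cis (\<delta> - real k * angle_step n * real i))"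
proof -
  define w where "w = cis (\<delta> - real k * angle_step n * real i)"
  define f :: "int \<Rightarrow> real" where "f x = Re (cis (\<delta> + real k * angle_step n * of_int x))" for x
  have "f (x + int (n + 2)) = f x" for x
  proof -
    have "\<delta> + real k * angle_step n * of_int (x + int (n + 2))
        = \<delta> + real k * angle_step n * of_int x + real k * ((real n + 2) * angle_step n)"
      by (simp add: algebra_simps)
    also have "\<dots> = \<delta> + real k * angle_step n * of_int x + 2 * pi * of_int (int k)"
      by (simp add: step_period)
    finally show ?thesis unfolding f_def by (simp only: cis_add_2pi_int)
  qed
  from anticirculant_periodic [where f = f, OF assms this, of a b c i]
  have "(\<Sum>l<n + 2. anticirculant n a b c i l * cos (\<delta> + real k * angle_step n * real l))
      = b * f (- int i) + a * f (- int i - 2) + c * f (- int i - 1)"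
    by (simp add: f_def)
  also have "\<dots> = Re (of_real b * w + of_real a * (cis (- (2 * (real k * angle_step n))) * w)
      + of_real c * (cis (- (real k * angle_step n)) * w))"
  proof -
    have "f (- int i - r) = Re (cis (- (of_int r * (real k * angle_step n))) * w)" for r
    proof -
      have "\<delta> + real k * angle_step n * of_int (- int i - r)
          = - (of_int r * (real k * angle_step n)) + (\<delta> - real k * angle_step n * real i)"
        by (simp add: algebra_simps)
      then show ?thesis
        by (simp only: f_def w_def cis_mult)
    qed
    from this [of 0] this [of 1] this [of 2] show ?thesis
      by simp
  qed
  also have "\<dots> = Re (cnj (lam n a b c k) * w)"
    by (simp only: lam_cis complex_cnj_add complex_cnj_mult complex_cnj_complex_of_real cis_cnj
        distrib_right mult.assoc)
  finally show ?thesis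
    by (simp only: w_def)
qed

lemma anticirculant_eigenfunction_real:
  assumes "n \<ge> 1" and "Im (lam n a b c k) = 0"
  shows "(\<Sum>l<n + 2. anticirculant n a b c i l * cos (real k * angle_step n * real l))
    = Re (lam n a b c k) * cos (real k * angle_step n * real i)"
  using anticirculant_wave [OF assms(1), of a b c i 0 k] assms(2) by simp

lemma cnj_lam_cis:
  "cnj (lam n a b c k) * cis (theta n a b c k / 2 + x)
    = of_real (cmod (lam n a b c k)) * cis (- (theta n a b c k / 2 - x))"
proof -
  have "cnj (lam n a b c k) = of_real (cmod (lam n a b c k)) * cis (- theta n a b c k)"
    using rcis_cmod_Arg [of "lam n a b c k"]
    by (metis cis_cnj complex_cnj_complex_of_real complex_cnj_mult rcis_def theta_def)
  then show ?thesis
    by (simp add: mult.assoc cis_mult)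
qed

text \<open>
  Up to the factor \<open>\<bar>\<lambda>\<^sub>k\<bar>\<close>, the matrix sends a cosine wave of phase \<open>\<delta>\<close> to one of phase
  \<open>\<theta>\<^sub>k - \<delta>\<close>; the phase \<open>\<theta>\<^sub>k / 2\<close> is fixed.
\<close>

lemma anticirculant_eigenfunction_cos:
  assumes "n \<ge> 1"
  shows "(\<Sum>l<n + 2. anticirculant n a b c i l *
      cos (theta n a b c k / 2 + real k * angle_step n * real l))
    = cmod (lam n a b c k) * cos (theta n a b c k / 2 + real k * angle_step n * real i)"
proof -
  have "cos (- (theta n a b c k / 2 - - (real k * angle_step n * real i)))
      = cos (theta n a b c k / 2 + real k * angle_step n * real i)"
    by (subst cos_minus) simp
  then show ?thesis
    unfolding anticirculant_wave [OF assms]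
    using cnj_lam_cis [of n a b c k "- (real k * angle_step n * real i)"] by simp
qed

text \<open>
  The sine wave is a cosine wave of phase \<open>\<theta>\<^sub>k / 2 - \<pi> / 2\<close>, which is sent to the phase
  \<open>\<theta>\<^sub>k / 2 + \<pi> / 2\<close>; the difference of half a turn makes the eigenvalue negative.
\<close>

lemma anticirculant_eigenfunction_sin:
  assumes "n \<ge> 1"
  shows "(\<Sum>l<n + 2. anticirculant n a b c i l *
      sin (theta n a b c k / 2 + real k * angle_step n * real l))
    = - cmod (lam n a b c k) * sin (theta n a b c k / 2 + real k * angle_step n * real i)"
proof -
  define y where "y = real k * angle_step n * real i"
  have shift: "sin (theta n a b c k / 2 + x) = cos (theta n a b c k / 2 - pi / 2 + x)" for x
    by (simp add: sin_cos_eq) (metis cos_minus minus_diff_eq diff_diff_eq2 add_diff_eq diff_add_eq)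
  have c: "cos (- (theta n a b c k / 2 - (- pi / 2 - y))) = - sin (theta n a b c k / 2 + y)"
  proof -
    have "cos (- (theta n a b c k / 2 - (- pi / 2 - y))) = cos ((theta n a b c k / 2 + y) + pi / 2)"
      by (subst cos_minus) (simp add: algebra_simps)
    then show ?thesis by (simp add: cos_add)
  qed
  have "(\<Sum>l<n + 2. anticirculant n a b c i l *
      sin (theta n a b c k / 2 + real k * angle_step n * real l))
    = Re (cnj (lam n a b c k) * cis (theta n a b c k / 2 + (- pi / 2 - y)))"
    unfolding shift anticirculant_wave [OF assms] y_def by (simp add: algebra_simps)
  also have "\<dots> = - cmod (lam n a b c k) * sin (theta n a b c k / 2 + y)"
    unfolding cnj_lam_cis using c by simp
  finally show ?thesis by (simp add: y_def)
qed


section \<open>The resolvent of the anticirculant matrix\<close>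

text \<open>
  The frequencies that equal their own negatives modulo \<open>n + 2\<close>: their waves take only the values
  \<open>\<plusminus> 1\<close>, and they pair with no other frequency.
\<close>

definition real_mode :: "nat \<Rightarrow> nat \<Rightarrow> bool" where
  "real_mode n k \<longleftrightarrow> k = 0 \<or> 2 * k = n + 2"

text \<open>
  The contribution of the frequencies \<open>k\<close> and \<open>n + 2 - k\<close> together to \<open>n + 2\<close> times the resolvent.
  Positions are integers, so that the last row can be addressed as \<open>- 1\<close>. For a self-paired
  frequency \<open>\<lambda>\<^sub>k\<close> is itself an eigenvalue; writing \<open>t - \<lambda>\<^sub>k\<close> there, and not
  \<open>t \<plusminus> \<bar>\<lambda>\<^sub>k\<bar>\<close>, avoids the spurious pole \<open>- \<lambda>\<^sub>k\<close>.
\<close>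

definition mode :: "nat \<Rightarrow> real \<Rightarrow> real \<Rightarrow> real \<Rightarrow> real \<Rightarrow> nat \<Rightarrow> int \<Rightarrow> int \<Rightarrow> real" where
  "mode n a b c t k x y =
     (let \<phi> = real k * angle_step n; \<theta> = theta n a b c k / 2 in
      if real_mode n k then cos (\<phi> * x) * cos (\<phi> * y) / (t - Re (lam n a b c k))
      else 2 * (cos (\<theta> + \<phi> * x) * cos (\<theta> + \<phi> * y) / (t - cmod (lam n a b c k))
              + sin (\<theta> + \<phi> * x) * sin (\<theta> + \<phi> * y) / (t + cmod (lam n a b c k))))"

definition modal_kernel :: "nat \<Rightarrow> real \<Rightarrow> real \<Rightarrow> real \<Rightarrow> real \<Rightarrow> int \<Rightarrow> int \<Rightarrow> real" where
  "modal_kernel n a b c t x y = (\<Sum>k\<le>(n + 2) div 2. mode n a b c t k x y)"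

definition mode_pole :: "nat \<Rightarrow> real \<Rightarrow> real \<Rightarrow> real \<Rightarrow> real \<Rightarrow> nat \<Rightarrow> bool" where
  "mode_pole n a b c t k \<longleftrightarrow>
     (if real_mode n k then t = Re (lam n a b c k)
      else t = cmod (lam n a b c k) \<or> t = - cmod (lam n a b c k))"

lemma kernel_commute: "modal_kernel n a b c t x y = modal_kernel n a b c t y x"
proof -
  have "mode n a b c t k x y = mode n a b c t k y x" for k
    unfolding mode_def Let_def by (simp only: mult.commute)
  then show ?thesis by (simp add: modal_kernel_def)
qed

lemma kernel_periodic: "modal_kernel n a b c t x (y + int (n + 2)) = modal_kernel n a b c t x y"
proof -
  have shift: "z + real k * angle_step n * of_int (y + int (n + 2))
      = z + real k * angle_step n * of_int y + 2 * pi * of_int (int k)" for z k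
  proof -
    have "z + real k * angle_step n * of_int (y + int (n + 2))
        = z + real k * angle_step n * of_int y + real k * ((real n + 2) * angle_step n)"
      by (simp add: algebra_simps)
    then show ?thesis by (simp add: step_period)
  qed
  have cis_shift: "cis (z + real k * angle_step n * of_int (y + int (n + 2)))
      = cis (z + real k * angle_step n * of_int y)" for z k
    by (simp only: shift cis_add_2pi_int)
  have cos_shift: "cos (z + real k * angle_step n * of_int (y + int (n + 2)))
      = cos (z + real k * angle_step n * of_int y)" for z k
    using arg_cong [OF cis_shift, of Re] by (simp only: cis.sel)
  have sin_shift: "sin (z + real k * angle_step n * of_int (y + int (n + 2)))
      = sin (z + real k * angle_step n * of_int y)" for z k
    using arg_cong [OF cis_shift, of Im] by (simp only: cis.sel)
  show ?thesis
    by (simp only: modal_kernel_def mode_def Let_def cos_shift sin_shift cos_shift [of 0, unfolded add_0_left])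
qed

lemma real_mode_half:
  assumes "real_mode n k" "k \<noteq> 0"
  shows "even n" "k = n div 2 + 1" "real k * angle_step n = pi"
proof -
  have k: "2 * k = n + 2" using assms by (simp add: real_mode_def)
  then show "even n" by presburger
  show "k = n div 2 + 1" using k by presburger
  have "real n + 2 = 2 * real k" using k by linarith
  then show "real k * angle_step n = pi" using assms(2) by (simp add: angle_step_def)
qed

lemma Im_lam_real_mode: "real_mode n k \<Longrightarrow> Im (lam n a b c k) = 0"
proof (cases "k = 0")
  case False
  assume "real_mode n k"
  from real_mode_half(1,2) [OF this False] show ?thesis
    using lam_half [of n a b c] by (metis Im_complex_of_real)
qed (simp add: lam_0)

lemma sin_real_mode:
  assumes "real_mode n k"
  shows "sin (real k * angle_step n * of_int x) = 0"
proof (cases "k = 0")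
  case False
  then show ?thesis
    using real_mode_half(3) [OF assms] by (simp add: sin_npi_int mult.commute)
qed simp

lemma scaled_eigenfunction:
  fixes A :: "nat \<Rightarrow> nat \<Rightarrow> real"
  assumes "(\<Sum>l<N. A i l * g l) = e * g i" and "t \<noteq> e"
  shows "t * (g i * y / (t - e)) - (\<Sum>l<N. A i l * (g l * y / (t - e))) = g i * y"
proof -
  have "(\<Sum>l<N. A i l * (g l * y / (t - e))) = (\<Sum>l<N. A i l * g l) * (y / (t - e))"
    by (simp add: sum_distrib_right sum_divide_distrib mult.assoc)
  then show ?thesis
    using assms by (simp add: divide_simps) (simp add: algebra_simps)
qed

text \<open>
  The denominators \<open>t \<plusminus> \<bar>\<lambda>\<^sub>k\<bar>\<close> cancel because the waves are eigenfunctions, and the addition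
  theorem for the cosine makes the phases \<open>\<theta>\<^sub>k\<close> disappear as well.
\<close>

lemma mode_resolvent:
  assumes n: "n \<ge> 1" and t: "\<not> mode_pole n a b c t k"
  shows "t * mode n a b c t k (int i) y
      - (\<Sum>l<n + 2. anticirculant n a b c i l * mode n a b c t k (int l) y)
    = (if real_mode n k then 1 else 2) * cos (real k * angle_step n * of_int (int i - y))"
proof (cases "real_mode n k")
  case True
  have "t * mode n a b c t k (int i) y
      - (\<Sum>l<n + 2. anticirculant n a b c i l * mode n a b c t k (int l) y)
    = cos (real k * angle_step n * real i) * cos (real k * angle_step n * of_int y)"
    using scaled_eigenfunction [where A = "anticirculant n a b c" and i = i
          and g = "\<lambda>l. cos (real k * angle_step n * real l)",
        OF anticirculant_eigenfunction_real [OF n Im_lam_real_mode [OF True]],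
        where t = t and y = "cos (real k * angle_step n * of_int y)"]
      t True by (simp add: mode_def mode_pole_def Let_def)
  also have "\<dots> = cos (real k * angle_step n * of_int (int i - y))"
    using sin_real_mode [OF True, of y] by (simp add: right_diff_distrib cos_diff)
  finally show ?thesis using True by simp
next
  case False
  define \<phi> where "\<phi> = real k * angle_step n"
  define \<theta> where "\<theta> = theta n a b c k / 2"
  define r where "r = cmod (lam n a b c k)"
  define cy where "cy = cos (\<theta> + \<phi> * of_int y)"
  define sy where "sy = sin (\<theta> + \<phi> * of_int y)"
  have mode: "mode n a b c t k (int l) y
      = 2 * (cos (\<theta> + \<phi> * l) * cy / (t - r) + sin (\<theta> + \<phi> * l) * sy / (t - - r))" for l
    using False by (simp add: mode_def Let_def \<phi>_def \<theta>_def r_def cy_def sy_def)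
  have 1: "t * (cos (\<theta> + \<phi> * i) * cy / (t - r))
      - (\<Sum>l<n + 2. anticirculant n a b c i l * (cos (\<theta> + \<phi> * l) * cy / (t - r)))
      = cos (\<theta> + \<phi> * i) * cy"
    using anticirculant_eigenfunction_cos [OF n, of a b c i k] t False
    by (intro scaled_eigenfunction) (simp_all add: \<phi>_def \<theta>_def r_def mode_pole_def)
  have 2: "t * (sin (\<theta> + \<phi> * i) * sy / (t - - r))
      - (\<Sum>l<n + 2. anticirculant n a b c i l * (sin (\<theta> + \<phi> * l) * sy / (t - - r)))
      = sin (\<theta> + \<phi> * i) * sy"
    using anticirculant_eigenfunction_sin [OF n, of a b c i k] t False
    by (intro scaled_eigenfunction) (simp_all add: \<phi>_def \<theta>_def r_def mode_pole_def)
  have "(\<Sum>l<n + 2. anticirculant n a b c i l * mode n a b c t k (int l) y)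
      = 2 * ((\<Sum>l<n + 2. anticirculant n a b c i l * (cos (\<theta> + \<phi> * l) * cy / (t - r)))
        + (\<Sum>l<n + 2. anticirculant n a b c i l * (sin (\<theta> + \<phi> * l) * sy / (t - - r))))"
    unfolding mode sum_distrib_left sum.distrib [symmetric] by (simp only: distrib_left mult_ac)
  then have "t * mode n a b c t k (int i) y
      - (\<Sum>l<n + 2. anticirculant n a b c i l * mode n a b c t k (int l) y)
      = 2 * ((t * (cos (\<theta> + \<phi> * i) * cy / (t - r))
          - (\<Sum>l<n + 2. anticirculant n a b c i l * (cos (\<theta> + \<phi> * l) * cy / (t - r))))
        + (t * (sin (\<theta> + \<phi> * i) * sy / (t - - r))
          - (\<Sum>l<n + 2. anticirculant n a b c i l * (sin (\<theta> + \<phi> * l) * sy / (t - - r)))))"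
    unfolding mode [of i] by (simp only: distrib_left right_diff_distrib mult.left_commute [of t])
  also have "\<dots> = 2 * (cos (\<theta> + \<phi> * i) * cy + sin (\<theta> + \<phi> * i) * sy)"
    by (simp only: 1 2)
  also have "cos (\<theta> + \<phi> * i) * cy + sin (\<theta> + \<phi> * i) * sy = cos ((\<theta> + \<phi> * i) - (\<theta> + \<phi> * of_int y))"
    by (simp only: cos_diff cy_def sy_def)
  also have "(\<theta> + \<phi> * i) - (\<theta> + \<phi> * of_int y) = \<phi> * of_int (int i - y)"
    by (simp add: algebra_simps)
  finally show ?thesis using False by (simp add: \<phi>_def)
qed

text \<open>
  The indices above \<open>N / 2\<close> mirror those strictly between \<open>0\<close> and \<open>N / 2\<close>.
\<close>

lemma sum_fold_reflection:
  fixes g :: "nat \<Rightarrow> real"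
  assumes "N > 0" and g: "\<And>k. \<lbrakk>0 < k; k < N\<rbrakk> \<Longrightarrow> g (N - k) = g k"
  shows "(\<Sum>k<N. g k) = (\<Sum>k\<le>N div 2. (if k = 0 \<or> 2 * k = N then 1 else 2) * g k)"
proof -
  define L where "L = {k. 0 < k \<and> 2 * k < N}"
  define U where "U = {k. k < N \<and> N < 2 * k}"
  have fin: "finite U" unfolding U_def by simp
  have split: "{..<N} = {..N div 2} \<union> U" "{..N div 2} \<inter> U = {}"
    using assms(1) by (auto simp: U_def)
  have "(\<Sum>k\<in>U. g k) = (\<Sum>k\<in>L. g k)"
    by (rule sum.reindex_bij_witness [of _ "\<lambda>k. N - k" "\<lambda>k. N - k"])
      (auto simp: U_def L_def g)
  also have "\<dots> = (\<Sum>k\<le>N div 2. if k = 0 \<or> 2 * k = N then 0 else g k)"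
    by (intro sum.mono_neutral_cong_left) (auto simp: L_def)
  finally have "(\<Sum>k<N. g k)
      = (\<Sum>k\<le>N div 2. g k + (if k = 0 \<or> 2 * k = N then 0 else g k))"
    unfolding split(1) using fin split(2) by (simp add: sum.union_disjoint sum.distrib)
  also have "\<dots> = (\<Sum>k\<le>N div 2. (if k = 0 \<or> 2 * k = N then 1 else 2) * g k)"
    by (intro sum.cong) auto
  finally show ?thesis .
qed

lemma sum_cos_roots_of_unity:
  assumes "\<bar>d\<bar> < int (n + 2)"
  shows "(\<Sum>k<n + 2. cos (real k * angle_step n * of_int d)) = (real n + 2) * of_bool (d = 0)"
proof (cases "d = 0")
  case False
  define z where "z = cis (angle_step n * of_int d)"
  have zN: "z ^ (n + 2) = 1"
  proof -
    have "real (n + 2) * (angle_step n * of_int d) = (real n + 2) * angle_step n * of_int d"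
      by simp
    also have "\<dots> = 0 + 2 * pi * of_int d"
      by (simp add: step_period)
    finally have "z ^ (n + 2) = cis (0 + 2 * pi * of_int d)"
      unfolding z_def DeMoivre by (simp only:)
    then show ?thesis by (simp only: cis_add_2pi_int cis_zero)
  qed
  have "z \<noteq> 1"
  proof
    assume "z = 1"
    then have "Re z = 1" by simp
    then have "cos (angle_step n * of_int d) = 1"
      by (simp add: z_def)
    then obtain j :: int where "angle_step n * of_int d = of_int j * 2 * pi"
      using cos_one_2pi_int by metis
    then have "2 * pi * of_int d = 2 * pi * (of_int j * (real n + 2))"
      by (simp add: angle_step_def field_simps)
    then have "of_int d = of_int j * (real n + 2)"
      using pi_neq_zero by (simp only: mult_cancel_left) simp
    then have "of_int d = (of_int (j * int (n + 2)) :: real)" by simp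
    then have d: "d = j * int (n + 2)" by (simp only: of_int_eq_iff)
    with False have "j \<noteq> 0" by auto
    then have "1 * int (n + 2) \<le> \<bar>j\<bar> * int (n + 2)" by (intro mult_right_mono) auto
    with assms d show False by (simp add: abs_mult)
  qed
  with zN have "(\<Sum>k<n + 2. z ^ k) = 0"
    by (simp only: sum_gp_strict) simp
  then have "(\<Sum>k<n + 2. Re (z ^ k)) = 0"
    by (metis Re_sum zero_complex.sel(1))
  then show ?thesis
    using False by (simp add: z_def DeMoivre mult.assoc)
qed simp

lemma half_spectrum_orthogonality:
  assumes "\<bar>d\<bar> < int (n + 2)"
  shows "(\<Sum>k\<le>(n + 2) div 2. (if real_mode n k then 1 else 2) * cos (real k * angle_step n * of_int d))
    = (real n + 2) * of_bool (d = 0)"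
proof -
  have "cos (real (n + 2 - k) * angle_step n * of_int d) = cos (real k * angle_step n * of_int d)"
    if "k < n + 2" for k
  proof -
    have "real (n + 2 - k) * angle_step n * of_int d
        = (real n + 2) * angle_step n * of_int d - real k * angle_step n * of_int d"
      using that by (simp add: of_nat_diff algebra_simps)
    then have "real (n + 2 - k) * angle_step n * of_int d
        = - (real k * angle_step n * of_int d) + 2 * pi * of_int d"
      by (simp add: step_period)
    then have "cis (real (n + 2 - k) * angle_step n * of_int d) = cis (- (real k * angle_step n * of_int d))"
      by (simp only: cis_add_2pi_int)
    from arg_cong [OF this, of Re] show ?thesis by simp
  qed
  then show ?thesis
    unfolding sum_cos_roots_of_unity [OF assms, symmetric] real_mode_def
    by (intro sum_fold_reflection [symmetric]) auto
qed

lemma resolvent_kernel: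
  assumes n: "n \<ge> 1" and t: "\<forall>k\<in>{..(n + 2) div 2}. \<not> mode_pole n a b c t k"
  shows "resolvent (n + 2) (anticirculant n a b c)
    (\<lambda>i j. modal_kernel n a b c t (int i) (int j) / (real n + 2)) t"
proof -
  have inverse: "t * (modal_kernel n a b c t (int i) (int j) / (real n + 2))
      - (\<Sum>l<n + 2. anticirculant n a b c i l * (modal_kernel n a b c t (int l) (int j) / (real n + 2)))
      = of_bool (i = j)" if "i < n + 2" "j < n + 2" for i j
  proof -
    have "t * modal_kernel n a b c t (int i) (int j)
        - (\<Sum>l<n + 2. anticirculant n a b c i l * modal_kernel n a b c t (int l) (int j))
      = (\<Sum>k\<le>(n + 2) div 2. t * mode n a b c t k (int i) (int j)
          - (\<Sum>l<n + 2. anticirculant n a b c i l * mode n a b c t k (int l) (int j)))"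
      unfolding modal_kernel_def sum_distrib_left sum_subtractf
      by (subst sum.swap) (rule refl)
    also have "\<dots> = (\<Sum>k\<le>(n + 2) div 2. (if real_mode n k then 1 else 2)
          * cos (real k * angle_step n * of_int (int i - int j)))"
      using t by (intro sum.cong refl mode_resolvent n) auto
    also have "\<dots> = (real n + 2) * of_bool (i = j)"
      using that by (subst half_spectrum_orthogonality) auto
    finally have "t * modal_kernel n a b c t (int i) (int j)
        - (\<Sum>l<n + 2. anticirculant n a b c i l * modal_kernel n a b c t (int l) (int j))
      = (real n + 2) * of_bool (i = j)" .
    moreover have "t * (modal_kernel n a b c t (int i) (int j) / (real n + 2))
        - (\<Sum>l<n + 2. anticirculant n a b c i l * (modal_kernel n a b c t (int l) (int j) / (real n + 2)))
      = (t * modal_kernel n a b c t (int i) (int j)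
        - (\<Sum>l<n + 2. anticirculant n a b c i l * modal_kernel n a b c t (int l) (int j))) / (real n + 2)"
      by (simp only: times_divide_eq_right sum_divide_distrib [symmetric] diff_divide_distrib)
    ultimately show ?thesis by (simp add: add_eq_0_iff)
  qed
  show ?thesis
  proof
    fix i j assume ij: "i < n + 2" "j < n + 2"
    show "t * (modal_kernel n a b c t (int i) (int j) / (real n + 2))
      - (\<Sum>l<n + 2. anticirculant n a b c i l * (modal_kernel n a b c t (int l) (int j) / (real n + 2)))
      = of_bool (i = j)"
      using ij by (rule inverse)
    show "t * (modal_kernel n a b c t (int i) (int j) / (real n + 2))
      - (\<Sum>l<n + 2. modal_kernel n a b c t (int i) (int l) / (real n + 2) * anticirculant n a b c l j)
      = of_bool (i = j)"
      using inverse [OF ij(2,1)]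
      by (simp only: kernel_commute [of n a b c t "int i"] anticirculant_commute [of n a b c j]
          mult.commute [of "anticirculant n a b c _ _"] eq_commute [of i j])
  qed
qed

section \<open>Secular equation and eigenvectors of the Hankel matrix\<close>

text \<open>
  The corrected positions are \<open>p = 0\<close> and \<open>q = n + 1\<close>. By periodicity of the kernel the latter is
  position \<open>- 1\<close>, which corresponds to the angle \<open>2 \<pi> / (n + 2)\<close> in the trigonometric
  sums.
\<close>

lemma
  assumes n: "n \<ge> 1" and t: "\<forall>k\<in>{..(n + 2) div 2}. \<not> mode_pole n a b c t k"
  defines "N \<equiv> real n + 2" and "K \<equiv> modal_kernel n a b c t"
  defines "s \<equiv> 1 + a / N * K (-1) (-1) + b / N * K 0 0
      + a * b / N\<^sup>2 * K (-1) (-1) * K 0 0 - a * b / N\<^sup>2 * (K 0 (-1))\<^sup>2"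
  shows eigenvalue_hankel_iff: "eigenvalue (hankel n a b c) t \<longleftrightarrow> s = 0"
    and eigenvector_hankel: "\<lbrakk>s = 0; b * K 0 0 + N \<noteq> 0\<rbrakk> \<Longrightarrow>
      eigenvector (hankel n a b c)
        (vec (n + 2) (\<lambda>i. K (int i) (-1) - b * K 0 (-1) * K (int i) 0 / (b * K 0 0 + N))) t"
proof -
  interpret resolvent "n + 2" "anticirculant n a b c" "\<lambda>i j. K (int i) (int j) / N" t
    unfolding K_def N_def by (rule resolvent_kernel [OF n t])
  interpret two_diagonal_corrections "n + 2" "anticirculant n a b c"
    "\<lambda>i j. K (int i) (int j) / N" t 0 "n + 1" a b "hankel n a b c"
  proof
    show "hankel n a b c \<in> carrier_mat (n + 2) (n + 2)"
      by (simp add: hankel_def)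
  qed (rule hankel_eq_anticirculant [OF n] | simp)+
  have N: "N > 0" by (simp add: N_def)
  have last_column: "K x (int (n + 1)) = K x (-1)" for x
    using kernel_periodic [of n a b c t x "-1"] by (simp add: K_def)
  have last: "K (int (n + 1)) x = K (-1) x" for x
    using last_column [of x] by (simp only: K_def kernel_commute [of n a b c t x])
  have "secular = (1 + b * (K 0 0 / N)) * (1 + a * (K (-1) (-1) / N))
      - a * b * (K 0 (-1) / N) * (K 0 (-1) / N)"
    unfolding secular_def last last_column
    by (simp only: of_nat_0 K_def kernel_commute [of n a b c t "-1" 0])
  also have "\<dots> = s"
    unfolding s_def using N by (simp add: divide_simps power2_eq_square) (simp add: algebra_simps)
  finally have sec: "secular = s" .
  show "eigenvalue (hankel n a b c) t \<longleftrightarrow> s = 0"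
    using eigenvalue_iff_secular sec by simp
  assume "s = 0" and pivot: "b * K 0 0 + N \<noteq> 0"
  have pivot': "1 + b * (K (int 0) (int 0) / N) \<noteq> 0"
    using pivot N by (simp add: divide_simps add.commute)
  have "N * (K (int i) (int (n + 1)) / N - b * (K (int 0) (int (n + 1)) / N)
        / (1 + b * (K (int 0) (int 0) / N)) * (K (int i) (int 0) / N))
      = K (int i) (-1) - b * K 0 (-1) * K (int i) 0 / (b * K 0 0 + N)" for i
  proof -
    define D where "D = b * K 0 0 + N"
    have "1 + b * (K 0 0 / N) = D / N"
      using N by (simp add: D_def divide_simps)
    then show ?thesis
      unfolding last_column of_nat_0 D_def [symmetric]
      using N pivot [folded D_def] by (simp add: divide_simps)
  qed
  then show "eigenvector (hankel n a b c)
      (vec (n + 2) (\<lambda>i. K (int i) (-1) - b * K 0 (-1) * K (int i) 0 / (b * K 0 0 + N))) t"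
    using eigenvector_explicit [OF _ pivot', of N] sec \<open>s = 0\<close> N by simp
qed

lemma eigenvalue_hankel_iff_listed:
  assumes "lists_eigenvalues n a b c \<mu>"
  shows "eigenvalue (hankel n a b c) t \<longleftrightarrow> t \<in> \<mu> ` {1..n + 2}"
proof -
  have "hankel n a b c \<in> carrier_mat (n + 2) (n + 2)"
    by (simp add: hankel_def)
  then have "eigenvalue (hankel n a b c) t \<longleftrightarrow> (\<Prod>m = 1..n + 2. t - \<mu> m) = 0"
    using assms by (simp add: eigenvalue_root_char_poly lists_eigenvalues_def poly_prod)
  also have "\<dots> \<longleftrightarrow> t \<in> \<mu> ` {1..n + 2}"
    by (auto simp: prod_zero_iff simp del: prod.cl_ivl_Suc)
  finally show ?thesis .
qed

section \<open>The trigonometric sums as kernel values\<close>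

lemma F_fun_eq_kernel:
  assumes "odd n"
  shows "F_fun n a b c ((n + 1) div 2) t (- (angle_step n * of_int x)) (- (angle_step n * of_int y))
    = modal_kernel n a b c t x y"
proof -
  have M: "(n + 2) div 2 = (n + 1) div 2" using assms by presburger
  have nonreal: "\<not> real_mode n k" if "k \<noteq> 0" for k
    using that assms unfolding real_mode_def by presburger
  have first: "mode n a b c t 0 x y = 1 / (t - Re (lam n a b c 0))"
    by (simp add: mode_def real_mode_def)
  have "{..(n + 1) div 2} = insert 0 {1..(n + 1) div 2}" by auto
  then have "modal_kernel n a b c t x y = mode n a b c t 0 x y
      + (\<Sum>k = 1..(n + 1) div 2. mode n a b c t k x y)"
    unfolding modal_kernel_def M by simp
  also have "(\<Sum>k = 1..(n + 1) div 2. mode n a b c t k x y) = 2 * (\<Sum>k = 1..(n + 1) div 2.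
         cos (theta n a b c k / 2 - - (angle_step n * of_int x) * real k)
           * cos (theta n a b c k / 2 - - (angle_step n * of_int y) * real k) / (t - cmod (lam n a b c k))
       + sin (theta n a b c k / 2 - - (angle_step n * of_int x) * real k)
           * sin (theta n a b c k / 2 - - (angle_step n * of_int y) * real k) / (t + cmod (lam n a b c k)))"
    unfolding sum_distrib_left using nonreal
    by (intro sum.cong) (simp_all add: mode_def Let_def mult_ac)
  finally show ?thesis
    unfolding F_fun_def first by simp
qed

text \<open>
  \<open>G_fun\<close> always takes the summand of the frequency \<open>n / 2 + 1\<close> with coefficient 1, whereas in the
  kernel it carries the alternating sign \<open>cos (\<pi> (x + y))\<close>. The difference accounts for the correction
  terms in \<open>g_even\<close> and \<open>v_entry\<close>.
\<close>

lemma G_fun_eq_kernel: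
  assumes "even n"
  shows "G_fun n a b c (n div 2) t (- (angle_step n * of_int x)) (- (angle_step n * of_int y))
    = modal_kernel n a b c t x y + (1 - cos (pi * of_int (x + y))) / (t - Re (lam n a b c (n div 2 + 1)))"
proof -
  have M: "(n + 2) div 2 = n div 2 + 1" by presburger
  have nonreal: "\<not> real_mode n k" if "k \<in> {1..n div 2}" for k
    using that unfolding real_mode_def by auto
  have half: "real_mode n (n div 2 + 1)"
    using assms unfolding real_mode_def by presburger
  have "cos (real (n div 2 + 1) * angle_step n * of_int x) * cos (real (n div 2 + 1) * angle_step n * of_int y)
      = cos (pi * of_int (x + y))"
  proof -
    have "real (n div 2 + 1) * angle_step n = pi"
      using real_mode_half(3) [OF half] by simp
    then show ?thesis
      by (simp only: of_int_add distrib_left cos_add sin_npi_int)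
  qed
  then have last: "mode n a b c t (n div 2 + 1) x y
      = cos (pi * of_int (x + y)) / (t - Re (lam n a b c (n div 2 + 1)))"
    using half by (simp only: mode_def Let_def if_True)
  have first: "mode n a b c t 0 x y = 1 / (t - Re (lam n a b c 0))"
    by (simp add: mode_def real_mode_def)
  have "{..n div 2 + 1} = insert 0 (insert (n div 2 + 1) {1..n div 2})" by auto
  then have "modal_kernel n a b c t x y = mode n a b c t 0 x y + mode n a b c t (n div 2 + 1) x y
      + (\<Sum>k = 1..n div 2. mode n a b c t k x y)"
    unfolding modal_kernel_def M by simp
  also have "(\<Sum>k = 1..n div 2. mode n a b c t k x y) = 2 * (\<Sum>k = 1..n div 2.
         cos (theta n a b c k / 2 - - (angle_step n * of_int x) * real k)
           * cos (theta n a b c k / 2 - - (angle_step n * of_int y) * real k) / (t - cmod (lam n a b c k))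
       + sin (theta n a b c k / 2 - - (angle_step n * of_int x) * real k)
           * sin (theta n a b c k / 2 - - (angle_step n * of_int y) * real k) / (t + cmod (lam n a b c k)))"
    unfolding sum_distrib_left using nonreal
    by (intro sum.cong) (simp_all add: mode_def Let_def mult_ac)
  finally show ?thesis
    unfolding G_fun_def first last diff_divide_distrib by simp
qed

lemma pole_form_odd_iff:
  assumes "odd n"
  shows "pole_form_odd n a b c t \<longleftrightarrow> (\<exists>k\<in>{..(n + 2) div 2}. mode_pole n a b c t k)"
proof -
  have M: "(n + 2) div 2 = (n + 1) div 2" using assms by presburger
  have nonreal: "\<not> real_mode n k" if "k \<noteq> 0" for k
    using that assms unfolding real_mode_def by presburger
  have "{..(n + 1) div 2} = insert 0 {1..(n + 1) div 2}" by auto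
  moreover have "mode_pole n a b c t 0 \<longleftrightarrow> complex_of_real t = lam n a b c 0"
    by (simp add: mode_pole_def real_mode_def lam_0 complex_eq_iff)
  ultimately have "(\<exists>k\<in>{..(n + 1) div 2}. mode_pole n a b c t k) \<longleftrightarrow>
      complex_of_real t = lam n a b c 0 \<or> (\<exists>k\<in>{1..(n + 1) div 2}. mode_pole n a b c t k)"
    by simp
  moreover have "(\<exists>k\<in>{1..(n + 1) div 2}. mode_pole n a b c t k) \<longleftrightarrow>
      (\<exists>k\<in>{1..(n + 1) div 2}. t = cmod (lam n a b c k) \<or> t = - cmod (lam n a b c k))"
    using nonreal by (intro bex_cong) (simp_all add: mode_pole_def)
  ultimately show ?thesis
    by (simp only: M pole_form_odd_def)
qed

lemma pole_form_even_iff: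
  assumes "even n"
  shows "pole_form_even n a b c t \<longleftrightarrow> (\<exists>k\<in>{..(n + 2) div 2}. mode_pole n a b c t k)"
proof -
  have M: "(n + 2) div 2 = n div 2 + 1" by presburger
  have nonreal: "\<not> real_mode n k" if "k \<in> {1..n div 2}" for k
    using that unfolding real_mode_def by auto
  have half: "real_mode n (n div 2 + 1)"
    using assms unfolding real_mode_def by presburger
  have "{..n div 2 + 1} = insert 0 (insert (n div 2 + 1) {1..n div 2})" by auto
  moreover have "mode_pole n a b c t 0 \<longleftrightarrow> complex_of_real t = lam n a b c 0"
    by (simp add: mode_pole_def real_mode_def lam_0 complex_eq_iff)
  moreover have "mode_pole n a b c t (n div 2 + 1) \<longleftrightarrow> complex_of_real t = lam n a b c (n div 2 + 1)"
    using half Im_lam_real_mode [OF half, of a b c] by (simp add: mode_pole_def complex_eq_iff)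
  ultimately have "(\<exists>k\<in>{..n div 2 + 1}. mode_pole n a b c t k) \<longleftrightarrow>
      complex_of_real t = lam n a b c 0 \<or> complex_of_real t = lam n a b c (n div 2 + 1)
      \<or> (\<exists>k\<in>{1..n div 2}. mode_pole n a b c t k)"
    by simp
  moreover have "(\<exists>k\<in>{1..n div 2}. mode_pole n a b c t k) \<longleftrightarrow>
      (\<exists>k\<in>{1..n div 2}. t = cmod (lam n a b c k) \<or> t = - cmod (lam n a b c k))"
    using nonreal by (intro bex_cong) (simp_all add: mode_pole_def)
  ultimately show ?thesis
    by (simp only: M pole_form_even_def)
qed


text \<open>
  A wave at position \<open>x\<close> corresponds to the angle \<open>- 2 \<pi> x / (n + 2)\<close>; these are the angles for the
  last position, for position \<open>i\<close>, and for the first position.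
\<close>

lemma angles_as_positions:
  "2 * pi / (real n + 2) = - (angle_step n * of_int (-1))"
  "2 * (1 - real (Suc i)) * pi / (real n + 2) = - (angle_step n * of_int (int i))"
  "0 = - (angle_step n * of_int 0)"
  by (simp_all add: angle_step_def)

lemma hankel_spectrum_odd:
  assumes "odd n" and n: "n \<ge> 1" and t: "\<not> pole_form_odd n a b c t"
  shows "eigenvalue (hankel n a b c) t \<longleftrightarrow> f_odd n a b c t = 0"
    and "\<lbrakk>f_odd n a b c t = 0; b * F_fun n a b c ((n + 1) div 2) t 0 0 + real n + 2 \<noteq> 0\<rbrakk>
      \<Longrightarrow> eigenvector (hankel n a b c) (u_vec n a b c t) t"
proof -
  let ?K = "modal_kernel n a b c t"
  have poles: "\<forall>k\<in>{..(n + 2) div 2}. \<not> mode_pole n a b c t k"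
    using t pole_form_odd_iff [OF assms(1)] by blast
  have F: "F_fun n a b c ((n + 1) div 2) t 0 0 = ?K 0 0"
    "F_fun n a b c ((n + 1) div 2) t 0 (2 * pi / (real n + 2)) = ?K 0 (-1)"
    "F_fun n a b c ((n + 1) div 2) t (2 * pi / (real n + 2)) (2 * pi / (real n + 2)) = ?K (-1) (-1)"
    "F_fun n a b c ((n + 1) div 2) t (2 * (1 - real (Suc i)) * pi / (real n + 2)) 0 = ?K (int i) 0"
    "F_fun n a b c ((n + 1) div 2) t (2 * (1 - real (Suc i)) * pi / (real n + 2))
       (2 * pi / (real n + 2)) = ?K (int i) (-1)" for i
    using F_fun_eq_kernel [OF assms(1), of a b c t] angles_as_positions by metis+
  have f: "f_odd n a b c t = 1 + a / (real n + 2) * ?K (-1) (-1) + b / (real n + 2) * ?K 0 0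
      + a * b / (real n + 2)\<^sup>2 * ?K (-1) (-1) * ?K 0 0 - a * b / (real n + 2)\<^sup>2 * (?K 0 (-1))\<^sup>2"
    unfolding f_odd_def Let_def F ..
  show "eigenvalue (hankel n a b c) t \<longleftrightarrow> f_odd n a b c t = 0"
    unfolding f by (rule eigenvalue_hankel_iff [OF n poles])
  assume "f_odd n a b c t = 0" "b * F_fun n a b c ((n + 1) div 2) t 0 0 + real n + 2 \<noteq> 0"
  then have "eigenvector (hankel n a b c) (vec (n + 2) (\<lambda>i. ?K (int i) (-1)
      - b * ?K 0 (-1) * ?K (int i) 0 / (b * ?K 0 0 + (real n + 2)))) t"
    unfolding f F by (intro eigenvector_hankel [OF n poles]) (simp_all only: add.assoc not_False_eq_True)
  then show "eigenvector (hankel n a b c) (u_vec n a b c t) t"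
    unfolding u_vec_def u_entry_def Let_def F .
qed

lemma hankel_spectrum_even:
  assumes "even n" and n: "n \<ge> 1" and t: "\<not> pole_form_even n a b c t"
  shows "eigenvalue (hankel n a b c) t \<longleftrightarrow> g_even n a b c t = 0"
    and "\<lbrakk>g_even n a b c t = 0; b * G_fun n a b c (n div 2) t 0 0 + real n + 2 \<noteq> 0\<rbrakk>
      \<Longrightarrow> eigenvector (hankel n a b c) (v_vec n a b c t) t"
proof -
  let ?K = "modal_kernel n a b c t" and ?G = "G_fun n a b c (n div 2) t"
  let ?d = "t - Re (lam n a b c (n div 2 + 1))" and ?N = "real n + 2"
  have poles: "\<forall>k\<in>{..(n + 2) div 2}. \<not> mode_pole n a b c t k"
    using t pole_form_even_iff [OF assms(1)] by blast
  have K: "?K x y = ?G (- (angle_step n * of_int x)) (- (angle_step n * of_int y))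
      - (1 - cos (pi * of_int (x + y))) / ?d" for x y
    unfolding G_fun_eq_kernel [OF assms(1)] by simp
  have G: "?G 0 0 = ?K 0 0"
    "?G 0 (2 * pi / ?N) - 2 / ?d = ?K 0 (-1)"
    "?G (2 * pi / ?N) (2 * pi / ?N) = ?K (-1) (-1)"
    unfolding K angles_as_positions(1) by simp_all
  have G_row: "?G (2 * (1 - real (Suc i)) * pi / ?N) 0 - (1 + (-1) ^ Suc i) / ?d = ?K (int i) 0"
    "?G (2 * (1 - real (Suc i)) * pi / ?N) (2 * pi / ?N) - (1 - (-1) ^ Suc i) / ?d = ?K (int i) (-1)"
    for i
  proof -
    have "cos (pi * of_int (int i + 0)) = - ((-1) ^ Suc i)"
      "cos (pi * of_int (int i + -1)) = (-1) ^ Suc i"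
      by (simp_all add: right_diff_distrib cos_diff)
    then show "?G (2 * (1 - real (Suc i)) * pi / ?N) 0 - (1 + (-1) ^ Suc i) / ?d = ?K (int i) 0"
      "?G (2 * (1 - real (Suc i)) * pi / ?N) (2 * pi / ?N) - (1 - (-1) ^ Suc i) / ?d
        = ?K (int i) (-1)"
      unfolding K angles_as_positions(1,2) by simp_all
  qed
  have g: "g_even n a b c t = 1 + a / ?N * ?K (-1) (-1) + b / ?N * ?K 0 0
      + a * b / ?N\<^sup>2 * ?K (-1) (-1) * ?K 0 0 - a * b / ?N\<^sup>2 * (?K 0 (-1))\<^sup>2"
    unfolding g_even_def Let_def G ..
  show "eigenvalue (hankel n a b c) t \<longleftrightarrow> g_even n a b c t = 0"
    unfolding g by (rule eigenvalue_hankel_iff [OF n poles])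
  assume "g_even n a b c t = 0" "b * ?G 0 0 + real n + 2 \<noteq> 0"
  then have "eigenvector (hankel n a b c) (vec (n + 2) (\<lambda>i. ?K (int i) (-1)
      - b * ?K 0 (-1) * ?K (int i) 0 / (b * ?K 0 0 + ?N))) t"
    unfolding g G by (intro eigenvector_hankel [OF n poles]) (simp_all only: add.assoc not_False_eq_True)
  moreover have "v_entry n a b c t (Suc i)
      = ?K (int i) (-1) - b * ?K 0 (-1) * ?K (int i) 0 / (b * ?K 0 0 + ?N)" for i
    unfolding v_entry_def Let_def G G_row by (simp only: mult_ac)
  ultimately show "eigenvector (hankel n a b c) (v_vec n a b c t) t"
    unfolding v_vec_def by (simp only:)
qed

theorem theorem2:
  fixes n :: nat and a b c :: real
  assumes "n \<ge> 1" and "a \<noteq> 0"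
  shows
    "(odd n \<longrightarrow>
       (\<forall>\<mu> :: nat \<Rightarrow> real.
          lists_eigenvalues n a b c \<mu> \<longrightarrow>
          (\<forall>m\<in>{1..n + 2}. \<not> pole_form_odd n a b c (\<mu> m)) \<longrightarrow>
          {t. \<not> pole_form_odd n a b c t \<and> f_odd n a b c t = 0} = \<mu> ` {1..n + 2} \<and>
          (\<forall>m\<in>{1..n + 2}.
             b * F_fun n a b c ((n + 1) div 2) (\<mu> m) 0 0 + real n + 2 \<noteq> 0 \<longrightarrow>
             eigenvector (hankel n a b c) (u_vec n a b c (\<mu> m)) (\<mu> m))))
     \<and>
     (even n \<longrightarrow>
       (\<forall>\<nu> :: nat \<Rightarrow> real.
          lists_eigenvalues n a b c \<nu> \<longrightarrow>
          (\<forall>m\<in>{1..n + 2}. \<not> pole_form_even n a b c (\<nu> m)) \<longrightarrow>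
          {t. \<not> pole_form_even n a b c t \<and> g_even n a b c t = 0} = \<nu> ` {1..n + 2} \<and>
          (\<forall>m\<in>{1..n + 2}.
             b * G_fun n a b c (n div 2) (\<nu> m) 0 0 + real n + 2 \<noteq> 0 \<longrightarrow>
             eigenvector (hankel n a b c) (v_vec n a b c (\<nu> m)) (\<nu> m))))"
proof -
  have zeros: "{t. \<not> P t \<and> h t = 0} = \<mu> ` {1..n + 2}"
    if "lists_eigenvalues n a b c \<mu>" "\<forall>m\<in>{1..n + 2}. \<not> P (\<mu> m)"
      and "\<And>t. \<not> P t \<Longrightarrow> eigenvalue (hankel n a b c) t \<longleftrightarrow> h t = 0"
    for \<mu> P and h :: "real \<Rightarrow> real"
  proof -
    have "t \<in> \<mu> ` {1..n + 2} \<longleftrightarrow> \<not> P t \<and> h t = 0" for t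
      using that(2,3) eigenvalue_hankel_iff_listed [OF that(1), of t] by blast
    then show ?thesis by blast
  qed
  show ?thesis
  proof (intro conjI impI allI)
    fix \<mu> :: "nat \<Rightarrow> real"
    assume "odd n" and listed: "lists_eigenvalues n a b c \<mu>"
      and poles: "\<forall>m\<in>{1..n + 2}. \<not> pole_form_odd n a b c (\<mu> m)"
    note odd = hankel_spectrum_odd [OF \<open>odd n\<close> \<open>n \<ge> 1\<close>]
    show *: "{t. \<not> pole_form_odd n a b c t \<and> f_odd n a b c t = 0} = \<mu> ` {1..n + 2}"
      using listed poles odd(1) by (rule zeros)
    show "\<forall>m\<in>{1..n + 2}. b * F_fun n a b c ((n + 1) div 2) (\<mu> m) 0 0 + real n + 2 \<noteq> 0 \<longrightarrow>
        eigenvector (hankel n a b c) (u_vec n a b c (\<mu> m)) (\<mu> m)"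
      using * odd(2) by blast
  next
    fix \<nu> :: "nat \<Rightarrow> real"
    assume "even n" and listed: "lists_eigenvalues n a b c \<nu>"
      and poles: "\<forall>m\<in>{1..n + 2}. \<not> pole_form_even n a b c (\<nu> m)"
    note even = hankel_spectrum_even [OF \<open>even n\<close> \<open>n \<ge> 1\<close>]
    show *: "{t. \<not> pole_form_even n a b c t \<and> g_even n a b c t = 0} = \<nu> ` {1..n + 2}"
      using listed poles even(1) by (rule zeros)
    show "\<forall>m\<in>{1..n + 2}. b * G_fun n a b c (n div 2) (\<nu> m) 0 0 + real n + 2 \<noteq> 0 \<longrightarrow>
        eigenvector (hankel n a b c) (v_vec n a b c (\<nu> m)) (\<nu> m)"
      using * even(2) by blast
  qed
qed

end
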